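(* Let $n,k\ge 1$ be integers and let $0\le a_1\le a_2\le\cdots\le a_n$ be real numbers. If $n$ divides $k$, then $v_{\min}(n,k)=n\prod_{i=1}^n a_i^{k/n}$, and this minimum is achieved by taking as the $k$ permutations each of the $n$ cyclic permutations $r_1,\dots,r_n$ of $\{1,\dots,n\}$ exactly $k/n$ times.
   Context: For a $k$-tuple $(\sigma_1,\dots,\sigma_k)$ of permutations of $\{1,\dots,n\}$ (repetitions allowed), let $v(n,k)=\sum_{i=1}^n\prod_{j=1}^k a_{\sigma_j(i)}$. $v_{\min}(n,k)$ denotes the minimum of $v(n,k)$ over all such $k$-tuples of permutations. The cyclic permutations are, in one-line notation, $r_1=(1,2,\dots,n)$, $r_2=(2,\dots,n,1)$, ..., $r_n=(n,1,\dots,n-1)$. *)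

theory Defs
  imports "HOL-Analysis.Analysis" "HOL-Combinatorics.Permutations"
begin

text \<open>
  Permutations of \<open>{1..n}\<close> are functions that are the identity outside \<open>{1..n}\<close>; tuples indexed
  by \<open>{1..k}\<close> are extensional functions, so that there are finitely many of them.
\<close>

definition perm_tuples :: "nat \<Rightarrow> nat \<Rightarrow> (nat \<Rightarrow> nat \<Rightarrow> nat) set" where
  "perm_tuples n k = {1..k} \<rightarrow>\<^sub>E {p. p permutes {1..n}}"

definition v :: "(nat \<Rightarrow> real) \<Rightarrow> nat \<Rightarrow> nat \<Rightarrow> (nat \<Rightarrow> nat \<Rightarrow> nat) \<Rightarrow> real" where
  "v a n k \<sigma> = (\<Sum>i=1..n. \<Prod>j=1..k. a (\<sigma> j i))"

definition v_min :: "(nat \<Rightarrow> real) \<Rightarrow> nat \<Rightarrow> nat \<Rightarrow> real" where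
  "v_min a n k = Min (v a n k ` perm_tuples n k)"

text \<open>
  \<open>cyclic_perm n m\<close>, for \<open>1 \<le> m \<le> n\<close>, is \<open>(m, m+1, \<dots>, n, 1, \<dots>, m-1)\<close> in one-line notation.
  The truncated subtraction is exact since \<open>m + i \<ge> 2\<close>.
\<close>

definition cyclic_perm :: "nat \<Rightarrow> nat \<Rightarrow> nat \<Rightarrow> nat" where
  "cyclic_perm n m i = (if i \<in> {1..n} then (m + i - 2) mod n + 1 else i)"

definition each_cyclic_times :: "nat \<Rightarrow> nat \<Rightarrow> nat \<Rightarrow> (nat \<Rightarrow> nat \<Rightarrow> nat) \<Rightarrow> bool" where
  "each_cyclic_times n k q \<sigma> \<longleftrightarrow>
     (\<forall>j\<in>{1..k}. \<sigma> j \<in> cyclic_perm n ` {1..n}) \<and>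
     (\<forall>m\<in>{1..n}. card {j \<in> {1..k}. \<sigma> j = cyclic_perm n m} = q)"

lemma finite_perm_tuples: "finite (perm_tuples n k)"
  unfolding perm_tuples_def by (intro finite_PiE finite_permutations) auto

lemma perm_tuples_nonempty: "perm_tuples n k \<noteq> {}"
  unfolding perm_tuples_def PiE_eq_empty_iff using permutes_id by blast

lemma cyclic_perm_one_line:
  assumes "m \<in> {1..n}"
  shows "map (cyclic_perm n m) [1..<n+1] = [m..<n+1] @ [1..<m]"
proof (rule nth_equalityI)
  show "length (map (cyclic_perm n m) [1..<n+1]) = length ([m..<n+1] @ [1..<m])"
    using assms by auto
next
  fix i assume "i < length (map (cyclic_perm n m) [1..<n+1])"
  then have i: "i < n" by (simp del: upt_Suc)
  have eq: "map (cyclic_perm n m) [1..<n+1] ! i = (m + i - 1) mod n + 1"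
    using i by (simp add: cyclic_perm_def del: upt_Suc)
  show "map (cyclic_perm n m) [1..<n+1] ! i = ([m..<n+1] @ [1..<m]) ! i"
  proof (cases "m + i - 1 < n")
    case True
    then have "i < Suc n - m" using assms by auto
    then show ?thesis unfolding eq using assms i True by (simp add: nth_append del: upt_Suc)
  next
    case False
    moreover have "m + i - 1 - n < n" using assms i by auto
    ultimately have "(m + i - 1) mod n = m + i - 1 - n"
      by (metis le_mod_geq mod_less not_less)
    moreover have "\<not> i < Suc n - m" "i - (Suc n - m) < m - 1" using assms i False by auto
    ultimately show ?thesis unfolding eq using assms i False by (simp add: nth_append del: upt_Suc)
  qed
qed

lemma cyclic_perm_permutes:
  assumes "m \<in> {1..n}"
  shows "cyclic_perm n m permutes {1..n}"
proof (rule bij_imp_permutes)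
  have "cyclic_perm n m ` set [1..<n+1] = set ([m..<n+1] @ [1..<m])"
    by (metis cyclic_perm_one_line[OF assms] set_map)
  moreover have "set ([m..<n+1] @ [1..<m]) = {1..n}" "set [1..<n+1] = {1..n}"
    using assms by auto
  ultimately have "cyclic_perm n m ` {1..n} = {1..n}" by simp
  then show "bij_betw (cyclic_perm n m) {1..n} {1..n}"
    by (simp add: bij_betw_def eq_card_imp_inj_on)
qed (auto simp: cyclic_perm_def)

end

theory Submission
  imports Defs
begin

text \<open>
  The product of the \<open>n\<close> summands of \<open>v\<close> does not depend on the permutations: it is
  \<open>(\<Prod>i=1..n. a i) ^ k\<close>. The lower bound is therefore the inequality of arithmetic and geometric
  means, and it is attained when all summands agree. They do for the cyclic permutations, because
  the table of \<open>cyclic_perm n m i\<close> is a symmetric Latin square.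
\<close>

lemma cyclic_perm_commute:
  assumes "i \<in> {1..n}" "m \<in> {1..n}"
  shows "cyclic_perm n m i = cyclic_perm n i m"
  using assms by (simp add: cyclic_perm_def add.commute)

text \<open>The value at 1 recovers the index, so distinct indices give distinct
  permutations.\<close>

lemma cyclic_perm_1:
  assumes "m \<in> {1..n}"
  shows "cyclic_perm n m 1 = m"
  using assms by (auto simp: cyclic_perm_def)

lemma inj_on_cyclic_perm: "inj_on (cyclic_perm n) {1..n}"
  by (rule inj_onI) (metis cyclic_perm_1)

text \<open>The positions counted are \<open>m + n * t\<close> with \<open>t < q\<close>, one in
  each block of \<open>n\<close> consecutive positions.\<close>

lemma card_congruent_eq:
  fixes n q m :: nat
  assumes "m \<in> {1..n}"
  shows "card {j \<in> {1..n * q}. (j - 1) mod n + 1 = m} = q"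
proof -
  have "{j \<in> {1..n * q}. (j - 1) mod n + 1 = m} = (\<lambda>t. m + n * t) ` {..<q}" (is "?L = ?R")
  proof
    show "?L \<subseteq> ?R"
    proof
      fix j assume j: "j \<in> ?L"
      then have "j = m + n * ((j - 1) div n)"
        using mult_div_mod_eq[of n "j - 1"] by auto
      moreover have "(j - 1) div n < q"
        using j assms by (intro less_mult_imp_div_less) (auto simp: mult.commute)
      ultimately show "j \<in> ?R" by blast
    qed
    show "?R \<subseteq> ?L"
    proof
      fix j assume "j \<in> ?R"
      then obtain t where t: "t < q" "j = m + n * t" by blast
      have "n * Suc t \<le> n * q" using t by (intro mult_le_mono) auto
      then have "j \<le> n * q" using t assms by auto
      have "j - 1 = (m - 1) + n * t" using t assms by auto
      moreover have "m - 1 < n" using assms by auto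
      ultimately have "(j - 1) mod n = m - 1" by simp
      then show "j \<in> ?L" using \<open>j \<le> n * q\<close> t assms by auto
    qed
  qed
  moreover have "inj_on (\<lambda>t. m + n * t) {..<q}"
    using assms by (auto simp: inj_on_def)
  ultimately show ?thesis by (simp add: card_image)
qed

text \<open>Deal the cyclic permutations out in turn: position \<open>j\<close> receives the one
  with index \<open>c j\<close>, and after \<open>n\<close> positions the round starts
  again.\<close>

lemma each_cyclic_times_exists:
  assumes "n \<ge> 1" and "n dvd k"
  shows "\<exists>\<sigma>\<in>perm_tuples n k. each_cyclic_times n k (k div n) \<sigma>"
proof -
  define c where "c j = (j - 1) mod n + 1" for j :: nat
  have c: "c j \<in> {1..n}" for j
    using assms(1) by (auto simp: c_def Suc_le_eq)
  define \<sigma> where "\<sigma> = (\<lambda>j\<in>{1..k}. cyclic_perm n (c j))"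
  have "\<sigma> \<in> perm_tuples n k"
    unfolding perm_tuples_def \<sigma>_def using cyclic_perm_permutes[OF c] by auto
  moreover have "card {j \<in> {1..k}. \<sigma> j = cyclic_perm n m} = k div n" if "m \<in> {1..n}" for m
  proof -
    \<comment> \<open>Injectivity turns equality of permutations into equality of indices, and
      divisibility gives \<open>n * (k div n) = k\<close>.\<close>
    have "{j \<in> {1..k}. \<sigma> j = cyclic_perm n m} = {j \<in> {1..n * (k div n)}. (j - 1) mod n + 1 = m}"
      using inj_on_eq_iff[OF inj_on_cyclic_perm c that] assms(2)
      by (simp add: \<sigma>_def c_def cong: conj_cong)
    then show ?thesis
      using card_congruent_eq[OF that] by simp
  qed
  then have "each_cyclic_times n k (k div n) \<sigma>"
    using c by (auto simp: each_cyclic_times_def \<sigma>_def)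
  ultimately show ?thesis by blast
qed

lemma v_each_cyclic_times:
  assumes "each_cyclic_times n k q \<sigma>"
  shows "v a n k \<sigma> = real n * (\<Prod>i=1..n. a i ^ q)"
proof -
  have "(\<Prod>j=1..k. a (\<sigma> j i)) = (\<Prod>i=1..n. a i ^ q)" if i: "i \<in> {1..n}" for i
  proof -
    \<comment> \<open>Group the factors by the permutation used; every \<open>\<sigma> j\<close> is
      cyclic, so no factor is lost.\<close>
    have "(\<Prod>j=1..k. a (\<sigma> j i))
        = (\<Prod>p\<in>cyclic_perm n ` {1..n}. \<Prod>j\<in>{j \<in> {1..k}. \<sigma> j = p}. a (\<sigma> j i))"
      using assms by (intro prod.group[symmetric]) (auto simp: each_cyclic_times_def)
    also have "\<dots> = (\<Prod>m=1..n. \<Prod>j\<in>{j \<in> {1..k}. \<sigma> j = cyclic_perm n m}. a (\<sigma> j i))"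
      by (subst prod.reindex[OF inj_on_cyclic_perm]) (simp only: comp_def)
    \<comment> \<open>By symmetry the bound variable \<open>m\<close> becomes the argument of the
      fixed permutation \<open>cyclic_perm n i\<close>, which can then be removed by
      reindexing.\<close>
    also have "\<dots> = (\<Prod>m=1..n. a (cyclic_perm n i m) ^ q)"
    proof (rule prod.cong[OF refl])
      fix m assume m: "m \<in> {1..n}"
      have "(\<Prod>j\<in>{j \<in> {1..k}. \<sigma> j = cyclic_perm n m}. a (\<sigma> j i))
          = (\<Prod>j\<in>{j \<in> {1..k}. \<sigma> j = cyclic_perm n m}. a (cyclic_perm n i m))"
        by (rule prod.cong) (auto simp: cyclic_perm_commute[OF i m])
      then show "(\<Prod>j\<in>{j \<in> {1..k}. \<sigma> j = cyclic_perm n m}. a (\<sigma> j i)) = a (cyclic_perm n i m) ^ q"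
        using assms m by (simp add: each_cyclic_times_def)
    qed
    also have "\<dots> = (\<Prod>m=1..n. a m ^ q)"
      using prod.permute[OF cyclic_perm_permutes[OF i], of "\<lambda>m. a m ^ q"] by (simp add: comp_def)
    finally show ?thesis .
  qed
  then show ?thesis by (simp add: v_def)
qed

lemma v_lower_bound:
  assumes "n \<ge> 1" and nonneg: "\<And>i. i \<in> {1..n} \<Longrightarrow> 0 \<le> a i"
    and "n dvd k" and \<sigma>: "\<sigma> \<in> perm_tuples n k"
  shows "real n * (\<Prod>i=1..n. a i ^ (k div n)) \<le> v a n k \<sigma>"
proof -
  define x where "x i = (\<Prod>j=1..k. a (\<sigma> j i))" for i
  have perm: "\<sigma> j permutes {1..n}" if "j \<in> {1..k}" for j
    using \<sigma> that by (auto simp: perm_tuples_def)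
  have x: "0 \<le> x i" if "i \<in> {1..n}" for i
    unfolding x_def
    by (intro prod_nonneg ballI nonneg) (use that permutes_in_image[OF perm] in simp)
  \<comment> \<open>After the exchange each inner product runs over a single permutation, which only
    reorders the \<open>a i\<close>.\<close>
  have "(\<Prod>i=1..n. x i) = (\<Prod>j=1..k. \<Prod>i=1..n. a (\<sigma> j i))"
    unfolding x_def by (rule prod.swap)
  also have "\<dots> = (\<Prod>j=1..k. \<Prod>i=1..n. a i)"
    using prod.permute[OF perm, of _ a] by (simp add: comp_def)
  also have "\<dots> = ((\<Prod>i=1..n. a i ^ (k div n))) ^ n"
    using assms(3) by (simp add: prod_power_distrib power_mult[symmetric])
  finally have prod: "(\<Prod>i=1..n. x i) = (\<Prod>i=1..n. a i ^ (k div n)) ^ n" .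
  have "(\<Prod>i=1..n. a i ^ (k div n)) = root n (\<Prod>i=1..n. x i)"
    unfolding prod using assms(1) nonneg
    by (intro real_root_power_cancel[symmetric]) (auto intro!: prod_nonneg)
  \<comment> \<open>This also covers a vanishing product: both the root and \<open>powr\<close> are
    then 0.\<close>
  also have "\<dots> = (\<Prod>i=1..n. x i) powr (1 / card {1..n})"
    using assms(1) x by (subst root_powr_inverse) (auto intro!: prod_nonneg)
  also have "\<dots> \<le> (\<Sum>i=1..n. x i / card {1..n})"
    using assms(1) x by (intro arith_geom_mean) auto
  finally have "(\<Prod>i=1..n. a i ^ (k div n)) \<le> (\<Sum>i=1..n. x i) / real n"
    by (simp add: sum_divide_distrib)
  then show ?thesis
    using assms(1) by (simp add: v_def x_def field_simps)
qed

theorem theorem1: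
  fixes n k :: nat and a :: "nat \<Rightarrow> real"
  assumes "n \<ge> 1" and "k \<ge> 1"
    and "0 \<le> a 1" and "mono_on {1..n} a"
    and "n dvd k"
  shows "v_min a n k = real n * (\<Prod>i=1..n. a i ^ (k div n))
    \<and> (\<exists>\<sigma>\<in>perm_tuples n k. each_cyclic_times n k (k div n) \<sigma>)
    \<and> (\<forall>\<sigma>\<in>perm_tuples n k. each_cyclic_times n k (k div n) \<sigma> \<longrightarrow> v a n k \<sigma> = v_min a n k)"
proof -
  have nonneg: "0 \<le> a i" if "i \<in> {1..n}" for i
    using that assms(1,3) mono_onD[OF assms(4), of 1 i] by auto
  obtain \<sigma> where \<sigma>: "\<sigma> \<in> perm_tuples n k" "each_cyclic_times n k (k div n) \<sigma>"
    using each_cyclic_times_exists[OF assms(1,5)] by blast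
  have "v_min a n k = real n * (\<Prod>i=1..n. a i ^ (k div n))"
    unfolding v_min_def
  proof (rule Min_eqI)
    show "finite (v a n k ` perm_tuples n k)"
      by (simp add: finite_perm_tuples)
    show "real n * (\<Prod>i=1..n. a i ^ (k div n)) \<in> v a n k ` perm_tuples n k"
      using \<sigma> v_each_cyclic_times by (metis image_eqI)
  next
    fix y assume "y \<in> v a n k ` perm_tuples n k"
    then show "real n * (\<Prod>i=1..n. a i ^ (k div n)) \<le> y"
      using v_lower_bound[OF assms(1) nonneg assms(5)] by auto
  qed
  \<comment> \<open>\<open>v_each_cyclic_times\<close> gives one value for all tuples with these
    multiplicities, so each of them attains the minimum.\<close>
  then show ?thesis
    using \<sigma> v_each_cyclic_times by auto
qed

end
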